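(* For $\sigma>0$ and $\beta>0$, the stationary distributions of the MFG system $$\frac{\sigma^2}{2}\partial_{xx}^2m+\partial_x(m\,\partial_xu)=0,\quad -\frac{|\partial_xu|^2}{2}+\log m+\beta x^2+\frac{\sigma^2}{2}\partial_{xx}^2u+\lambda=0\ \ (x\in\mathbb{R}),\quad \int_{\mathbb{R}}m\,dx=1,$$ and of the BRS equation $$\partial_x\big(m\,\partial_x(\log m+\beta x^2)\big)+\frac{\sigma^2}{2}\partial_{xx}^2m=0\ \ (x\in\mathbb{R}),\quad\int_{\mathbb{R}}m\,dx=1,$$ are given by normal distributions with mean $0$ and variances $a_1$ and $a_2$ respectively, where $$a_1=\frac{\sigma^4}{-2+2(1+2\sigma^4\beta)^{1/2}},\qquad a_2=\frac{2+\sigma^2}{4\beta}.$$ Moreover, for fixed $\beta>0$, $$\lim_{\sigma^2\to0}\frac{a_2}{a_1}=1,\qquad \lim_{\sigma^2\to\infty}\frac{a_2}{a_1}=\frac{1}{(2\beta)^{1/2}},$$ while for fixed $\sigma>0$, $$\lim_{\beta\to0}\frac{a_2}{a_1}=1+\frac{\sigma^2}{2},\qquad \lim_{\beta\to\infty}(2\beta)^{1/2}\frac{a_2}{a_1}=\frac{2+\sigma^2}{\sigma^2}.$$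
   Context: In the MFG system the unknowns are $m:\mathbb{R}\to(0,\infty)$, $u:\mathbb{R}\to\mathbb{R}$ and $\lambda\in\mathbb{R}$; no boundary condition or integral constraint is imposed on $u$. The stationary distribution of the MFG system refers to the density $m$ of its explicit solution with quadratic $u$, namely $u(x)=bx^2$ with $b=\frac{-1+(1+2\sigma^4\beta)^{1/2}}{2\sigma^2}$. In the BRS equation the unknown is $m:\mathbb{R}\to(0,\infty)$. *)

theory Defs
  imports "HOL-Probability.Distributions"
begin

definition twice_differentiable :: "(real \<Rightarrow> real) \<Rightarrow> bool" where
  "twice_differentiable f \<longleftrightarrow>
     (\<forall>x. f differentiable (at x)) \<and> (\<forall>x. deriv f differentiable (at x))"

(* Positive probability densities that are regular enough for the equations below to hold in the
   classical sense. Continuity of the second derivative is not required, so uniqueness is claimed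
   in the larger class. *)
definition regular_density :: "(real \<Rightarrow> real) \<Rightarrow> bool" where
  "regular_density m \<longleftrightarrow>
     (\<forall>x. 0 < m x) \<and> twice_differentiable m \<and> has_bochner_integral lborel m 1"

definition mfg_solution ::
  "real \<Rightarrow> real \<Rightarrow> (real \<Rightarrow> real) \<Rightarrow> (real \<Rightarrow> real) \<Rightarrow> real \<Rightarrow> bool" where
  "mfg_solution \<sigma> \<beta> m u l \<longleftrightarrow>
     regular_density m \<and> twice_differentiable u \<and>
     (\<forall>x. \<sigma>\<^sup>2 / 2 * deriv (deriv m) x + deriv (\<lambda>y. m y * deriv u y) x = 0) \<and>
     (\<forall>x. - (\<bar>deriv u x\<bar>\<^sup>2 / 2) + ln (m x) + \<beta> * x\<^sup>2 + \<sigma>\<^sup>2 / 2 * deriv (deriv u) x + l = 0)"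

definition mfg_b :: "real \<Rightarrow> real \<Rightarrow> real" where
  "mfg_b \<sigma> \<beta> = (- 1 + sqrt (1 + 2 * \<sigma>^4 * \<beta>)) / (2 * \<sigma>\<^sup>2)"

(* The MFG system puts no boundary condition on u; its stationary distribution is by convention
   the density belonging to the explicit quadratic value function. *)
definition mfg_stationary :: "real \<Rightarrow> real \<Rightarrow> (real \<Rightarrow> real) \<Rightarrow> bool" where
  "mfg_stationary \<sigma> \<beta> m \<longleftrightarrow> (\<exists>l. mfg_solution \<sigma> \<beta> m (\<lambda>x. mfg_b \<sigma> \<beta> * x\<^sup>2) l)"

definition brs_stationary :: "real \<Rightarrow> real \<Rightarrow> (real \<Rightarrow> real) \<Rightarrow> bool" where
  "brs_stationary \<sigma> \<beta> m \<longleftrightarrow>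
     regular_density m \<and>
     (\<forall>x. deriv (\<lambda>y. m y * deriv (\<lambda>z. ln (m z) + \<beta> * z\<^sup>2) y) x
          + \<sigma>\<^sup>2 / 2 * deriv (deriv m) x = 0)"

definition a1 :: "real \<Rightarrow> real \<Rightarrow> real" where
  "a1 \<sigma> \<beta> = \<sigma>^4 / (- 2 + 2 * sqrt (1 + 2 * \<sigma>^4 * \<beta>))"

definition a2 :: "real \<Rightarrow> real \<Rightarrow> real" where
  "a2 \<sigma> \<beta> = (2 + \<sigma>\<^sup>2) / (4 * \<beta>)"

end

theory Submission
  imports Defs "HOL-Real_Asymp.Real_Asymp"
begin

text \<open>
  Both systems reduce to first-order information that pins down a Gaussian.

  For the MFG system with \<open>u x = b * x\<^sup>2\<close>, the Hamilton--Jacobi--Bellman equation gives \<open>ln (m x)\<close>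
  up to a constant depending on \<open>l\<close>: a quadratic polynomial in \<open>x\<close> with leading coefficient
  \<open>2 * b\<^sup>2 - \<beta>\<close>. The number \<open>b\<close> is the positive root of \<open>2 * \<sigma>\<^sup>2 * b\<^sup>2 + 2 * b = \<sigma>\<^sup>2 * \<beta>\<close>, so this coefficient is \<open>- 1 / (2 * a1)\<close> and the
  normalisation of the mass determines \<open>m\<close> completely.

  For the BRS equation, \<open>m * (ln m)' = m'\<close>, so the equation is linear, and one integration turns it
  into \<open>m' + (x / a2) * m = c\<close>. Hence \<open>m * exp (x\<^sup>2 / (2 * a2))\<close> has derivative
  \<open>c * exp (x\<^sup>2 / (2 * a2))\<close>, whose modulus is at least \<open>\<bar>c\<bar>\<close>. For \<open>c \<noteq> 0\<close> such a function becomes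
  negative at one of the two ends of the line; positivity of \<open>m\<close> thus forces \<open>c\<close>, which is the
  probability flux up to a constant factor, to vanish (lemma \<open>positive_constant_flux\<close>), and the
  normalisation again gives the Gaussian.

  Conversely, the centred normal density with variance \<open>a\<close> satisfies \<open>m' = - (x / a) * m\<close>, which makes the flux
  vanish in either model, and its logarithm is the quadratic polynomial required in the MFG system.
  The four limits become transparent after rationalising \<open>a1\<close> to
  \<open>(1 + sqrt (1 + 2 * \<sigma>^4 * \<beta>)) / (4 * \<beta>)\<close>, which makes the ratio of the variances
  \<open>(2 + \<sigma>\<^sup>2) / (1 + sqrt (1 + 2 * \<sigma>^4 * \<beta>))\<close>.
\<close>

section \<open>The two variances\<close>

lemma a1_rationalised:
  assumes "\<sigma> > 0" "\<beta> > 0"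
  shows "a1 \<sigma> \<beta> = (1 + sqrt (1 + 2 * \<sigma>^4 * \<beta>)) / (4 * \<beta>)"
proof -
  define r where "r = sqrt (1 + 2 * \<sigma>^4 * \<beta>)"
  have r2: "r * r = 1 + 2 * \<sigma>^4 * \<beta>"
    unfolding r_def using assms by simp
  have r: "r > 1"
    unfolding r_def using assms by simp
  have "\<sigma>^4 * (4 * \<beta>) = (1 + r) * (- 2 + 2 * r)"
    using r2 by (simp add: algebra_simps)
  then show ?thesis
    using r assms unfolding a1_def r_def[symmetric] by (simp add: frac_eq_eq)
qed

lemma a1_pos:
  assumes "\<sigma> > 0" "\<beta> > 0"
  shows "a1 \<sigma> \<beta> > 0"
  using assms by (simp add: a1_rationalised add_pos_nonneg)

lemma a2_pos:
  assumes "\<beta> > 0"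
  shows "a2 \<sigma> \<beta> > 0"
  using assms by (simp add: a2_def add_pos_nonneg)

lemma mfg_b_eq:
  assumes "\<sigma> > 0" "\<beta> > 0"
  shows "mfg_b \<sigma> \<beta> = \<sigma>\<^sup>2 / (4 * a1 \<sigma> \<beta>)"
proof -
  have "sqrt (1 + 2 * \<sigma>^4 * \<beta>) > 1"
    using assms by simp
  then show ?thesis
    using assms by (simp add: mfg_b_def a1_def field_simps eval_nat_numeral)
qed

lemma mfg_b_quadratic:
  assumes "\<sigma> > 0" "\<beta> > 0"
  shows "2 * (mfg_b \<sigma> \<beta>)\<^sup>2 - \<beta> = - 1 / (2 * a1 \<sigma> \<beta>)"
proof -
  define r where "r = sqrt (1 + 2 * \<sigma>^4 * \<beta>)"
  have r2: "r * r = 1 + 2 * \<sigma>^4 * \<beta>"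
    unfolding r_def using assms by simp
  have b: "mfg_b \<sigma> \<beta> = (r - 1) / (2 * \<sigma>\<^sup>2)"
    by (simp add: mfg_b_def r_def)
  have "1 / (2 * a1 \<sigma> \<beta>) = 2 * mfg_b \<sigma> \<beta> / \<sigma>\<^sup>2"
    using assms a1_pos[OF assms] by (simp add: mfg_b_eq field_simps)
  moreover have "2 * (mfg_b \<sigma> \<beta>)\<^sup>2 + 2 * mfg_b \<sigma> \<beta> / \<sigma>\<^sup>2 = (r * r - 1) / (2 * \<sigma>^4)"
    unfolding b using assms by (simp add: field_simps eval_nat_numeral)
  moreover have "(r * r - 1) / (2 * \<sigma>^4) = \<beta>"
    unfolding r2 using assms by simp
  ultimately show ?thesis by simp
qed

lemma variance_ratio:
  assumes "\<sigma> > 0" "\<beta> > 0"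
  shows "a2 \<sigma> \<beta> / a1 \<sigma> \<beta> = (2 + \<sigma>\<^sup>2) / (1 + sqrt (1 + 2 * \<sigma>^4 * \<beta>))"
  using assms by (simp add: a1_rationalised a2_def)

lemma variance_ratio_sqrt:
  assumes "s > 0" "\<beta> > 0"
  shows "a2 (sqrt s) \<beta> / a1 (sqrt s) \<beta> = (2 + s) / (1 + sqrt (1 + 2 * s\<^sup>2 * \<beta>))"
proof -
  have "sqrt s ^ 4 = (sqrt s ^ 2) ^ 2"
    unfolding power_mult[symmetric] by simp
  then have "sqrt s ^ 4 = s\<^sup>2"
    using assms by simp
  then show ?thesis
    using variance_ratio[of "sqrt s" \<beta>] assms by simp
qed

section \<open>Centred normal densities\<close>

lemma normal_density_centred:
  assumes "a > 0"
  shows "normal_density 0 (sqrt a) x = 1 / sqrt (2 * pi * a) * exp (- x\<^sup>2 / (2 * a))"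
  using assms by (simp add: normal_density_def)

lemma normal_density_if_proportional:
  assumes "a > 0" "\<And>x. m x = C * exp (- x\<^sup>2 / (2 * a))" "has_bochner_integral lborel m 1"
  shows "m = normal_density 0 (sqrt a)"
proof -
  define K where "K = C * sqrt (2 * pi * a)"
  have m: "m = (\<lambda>x. K * normal_density 0 (sqrt a) x)"
    using assms(1,2) by (simp add: normal_density_centred K_def fun_eq_iff)
  have "integral\<^sup>L lborel m = K"
    unfolding m using assms(1) by (simp add: integral_normal_density)
  moreover have "integral\<^sup>L lborel m = 1"
    using assms(3) by (rule has_bochner_integral_integral_eq)
  ultimately have "K = 1"
    by simp
  then show ?thesis
    using m by simp
qed

lemma normal_density_centred_deriv:
  assumes "a > 0"
  shows "(normal_density 0 (sqrt a) has_real_derivative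
           - (x / a) * normal_density 0 (sqrt a) x) (at x)"
proof -
  have eq: "normal_density 0 (sqrt a) = (\<lambda>x. 1 / sqrt (2 * pi * a) * exp (- x\<^sup>2 / (2 * a)))"
    using assms by (simp add: normal_density_centred fun_eq_iff)
  show ?thesis
    unfolding eq using assms by (auto intro!: derivative_eq_intros simp: field_simps)
qed

lemma deriv_normal_density_centred:
  assumes "a > 0"
  shows "deriv (normal_density 0 (sqrt a)) = (\<lambda>x. - (x / a) * normal_density 0 (sqrt a) x)"
  using normal_density_centred_deriv[OF assms] by (auto intro!: DERIV_imp_deriv simp: fun_eq_iff)

lemma deriv_times_normal_density_centred:
  assumes "a > 0"
  shows "((\<lambda>x. c * x * normal_density 0 (sqrt a) x) has_real_derivative
           c * (1 - x\<^sup>2 / a) * normal_density 0 (sqrt a) x) (at x)"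
  using assms
  by (auto intro!: derivative_eq_intros normal_density_centred_deriv
           simp: field_simps power2_eq_square)

lemma deriv2_normal_density_centred:
  assumes "a > 0"
  shows "(deriv (normal_density 0 (sqrt a)) has_real_derivative
           - (1 / a) * (1 - x\<^sup>2 / a) * normal_density 0 (sqrt a) x) (at x)"
  using deriv_times_normal_density_centred[OF assms, of "- (1 / a)" x] assms
  by (simp add: deriv_normal_density_centred)

lemma regular_density_normal_density_centred:
  assumes "a > 0"
  shows "regular_density (normal_density 0 (sqrt a))"
proof -
  have "has_bochner_integral lborel (normal_density 0 (sqrt a)) 1"
    using assms by (simp add: has_bochner_integral_iff integrable_normal_density
        integral_normal_density)
  moreover have "twice_differentiable (normal_density 0 (sqrt a))"
    unfolding twice_differentiable_def real_differentiable_def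
    using normal_density_centred_deriv[OF assms] deriv2_normal_density_centred[OF assms] by blast
  moreover have "\<forall>x. 0 < normal_density 0 (sqrt a) x"
    using assms by (simp add: normal_density_pos)
  ultimately show ?thesis
    by (simp add: regular_density_def)
qed

section \<open>The MFG system\<close>

lemma deriv_quadratic: "deriv (\<lambda>x. b * x\<^sup>2) = (\<lambda>x::real. 2 * b * x)"
  by (rule ext, rule DERIV_imp_deriv) (auto intro!: derivative_eq_intros)

lemma deriv_linear: "deriv (\<lambda>x. c * x) = (\<lambda>x::real. c)"
  by (rule ext, rule DERIV_imp_deriv) (auto intro!: derivative_eq_intros)

lemma twice_differentiable_quadratic: "twice_differentiable (\<lambda>x. b * x\<^sup>2)"
  unfolding twice_differentiable_def deriv_quadratic
  by (auto intro!: derivative_intros)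

lemma mfg_stationary_iff:
  assumes "\<sigma> > 0" "\<beta> > 0"
  shows "mfg_stationary \<sigma> \<beta> m \<longleftrightarrow> m = normal_density 0 (sqrt (a1 \<sigma> \<beta>))"
proof
  define a where "a = a1 \<sigma> \<beta>"
  define b where "b = mfg_b \<sigma> \<beta>"
  have a: "a > 0"
    using a1_pos[OF assms] by (simp add: a_def)
  have coeff: "2 * b\<^sup>2 * x\<^sup>2 = \<beta> * x\<^sup>2 - x\<^sup>2 / (2 * a)" for x
  proof -
    have "2 * b\<^sup>2 = \<beta> - 1 / (2 * a)"
      using mfg_b_quadratic[OF assms] by (simp add: a_def b_def)
    then have "2 * b\<^sup>2 * x\<^sup>2 = (\<beta> - 1 / (2 * a)) * x\<^sup>2"
      by simp
    then show ?thesis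
      by (simp add: left_diff_distrib)
  qed
  {
    assume "mfg_stationary \<sigma> \<beta> m"
    then obtain l where sol: "mfg_solution \<sigma> \<beta> m (\<lambda>x. b * x\<^sup>2) l"
      by (auto simp: mfg_stationary_def b_def)
    have pos: "m x > 0" for x
      using sol by (simp add: mfg_solution_def regular_density_def)
    have "ln (m x) = - x\<^sup>2 / (2 * a) + (- \<sigma>\<^sup>2 * b - l)" for x
    proof -
      have "- (\<bar>2 * b * x\<bar>\<^sup>2 / 2) + ln (m x) + \<beta> * x\<^sup>2 + \<sigma>\<^sup>2 / 2 * (2 * b) + l = 0"
        using sol by (simp add: mfg_solution_def deriv_quadratic deriv_linear)
      then show ?thesis
        using coeff[of x] by (simp add: power_mult_distrib)
    qed
    then have "m x = exp (- x\<^sup>2 / (2 * a) + (- \<sigma>\<^sup>2 * b - l))" for x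
      using pos[of x] by (metis exp_ln)
    then have "m x = exp (- \<sigma>\<^sup>2 * b - l) * exp (- x\<^sup>2 / (2 * a))" for x
      by (simp only: exp_add mult.commute)
    moreover have "has_bochner_integral lborel m 1"
      using sol by (simp add: mfg_solution_def regular_density_def)
    ultimately show "m = normal_density 0 (sqrt (a1 \<sigma> \<beta>))"
      using normal_density_if_proportional[OF a] by (simp add: a_def)
  }
  {
    assume "m = normal_density 0 (sqrt (a1 \<sigma> \<beta>))"
    then have m: "m = normal_density 0 (sqrt a)"
      by (simp add: a_def)
    define l where "l = ln (sqrt (2 * pi * a)) - \<sigma>\<^sup>2 * b"
    have b: "b = \<sigma>\<^sup>2 / (4 * a)"
      using mfg_b_eq[OF assms] by (simp add: a_def b_def)
    have fp: "\<sigma>\<^sup>2 / 2 * deriv (deriv m) x + deriv (\<lambda>y. m y * (2 * b * y)) x = 0" for x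
    proof -
      have 1: "deriv (deriv m) x = - (1 / a) * (1 - x\<^sup>2 / a) * m x"
        unfolding m by (rule DERIV_imp_deriv) (rule deriv2_normal_density_centred[OF a])
      have "deriv (\<lambda>y. 2 * b * y * m y) x = 2 * b * (1 - x\<^sup>2 / a) * m x"
        unfolding m by (rule DERIV_imp_deriv) (rule deriv_times_normal_density_centred[OF a])
      then have 2: "deriv (\<lambda>y. m y * (2 * b * y)) x = 2 * b * (1 - x\<^sup>2 / a) * m x"
        by (simp only: mult.commute)
      show ?thesis
        unfolding 1 2 unfolding b using a by (simp add: field_simps)
    qed
    have "ln (m x) = - x\<^sup>2 / (2 * a) - ln (sqrt (2 * pi * a))" for x
      unfolding m normal_density_centred[OF a] using a by (simp add: ln_mult ln_div)
    then have hjb: "- (\<bar>2 * b * x\<bar>\<^sup>2 / 2) + ln (m x) + \<beta> * x\<^sup>2 + \<sigma>\<^sup>2 / 2 * (2 * b) + l = 0" for x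
      using coeff[of x] by (simp add: l_def power_mult_distrib)
    have "mfg_solution \<sigma> \<beta> m (\<lambda>x. b * x\<^sup>2) l"
      unfolding mfg_solution_def deriv_quadratic deriv_linear
      using fp hjb twice_differentiable_quadratic regular_density_normal_density_centred[OF a]
      by (auto simp: m)
    then show "mfg_stationary \<sigma> \<beta> m"
      by (auto simp: mfg_stationary_def b_def)
  }
qed

section \<open>The BRS equation\<close>

text \<open>The equation rewritten without the logarithm; the nonlinear term is linear in \<open>m\<close>.\<close>

lemma brs_flux_eq:
  fixes m :: "real \<Rightarrow> real"
  assumes "\<And>x. 0 < m x" "\<And>x. m differentiable (at x)"
  shows "(\<lambda>y. m y * deriv (\<lambda>z. ln (m z) + \<beta> * z\<^sup>2) y) = (\<lambda>y. deriv m y + 2 * \<beta> * y * m y)"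
proof
  fix y
  have D: "(m has_real_derivative deriv m y) (at y)"
    using assms(2) by (simp add: DERIV_deriv_iff_real_differentiable)
  have "deriv (\<lambda>z. ln (m z) + \<beta> * z\<^sup>2) y = deriv m y / m y + 2 * \<beta> * y"
    using assms(1)[of y]
    by (intro DERIV_imp_deriv) (auto intro!: derivative_eq_intros D simp: field_simps)
  then show "m y * deriv (\<lambda>z. ln (m z) + \<beta> * z\<^sup>2) y = deriv m y + 2 * \<beta> * y * m y"
    using assms(1)[of y] by (simp add: field_simps)
qed

text \<open>
  The positive solutions of \<open>m' + (x / a) * m = c\<close> on the whole line. Positivity alone, without
  integrability, excludes \<open>c \<noteq> 0\<close>.
\<close>

lemma positive_constant_flux:
  fixes m :: "real \<Rightarrow> real"
  assumes "a > 0" "\<And>x. 0 < m x"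
    and D: "\<And>x. (m has_real_derivative c - x / a * m x) (at x)"
  shows "m x = m 0 * exp (- x\<^sup>2 / (2 * a))"
proof -
  define G where "G = (\<lambda>x. m x * exp (x\<^sup>2 / (2 * a)))"
  have G: "(G has_real_derivative c * exp (x\<^sup>2 / (2 * a))) (at x)" for x
    unfolding G_def using assms(1)
    by (auto intro!: derivative_eq_intros D simp: field_simps)
  have Gpos: "G x > 0" for x
    using assms(2) by (simp add: G_def)
  have e1: "exp (x\<^sup>2 / (2 * a)) \<ge> 1" for x
    using assms(1) by simp
  have "c = 0"
  proof (rule ccontr)
    assume c: "c \<noteq> 0"
    \<comment> \<open>By the mean value theorem \<open>G (- s) \<le> G 0 - c * s\<close> for \<open>s\<close> of the sign of \<open>c\<close>; this \<open>s\<close>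
        is where the bound reaches zero.\<close>
    define s where "s = G 0 / c"
    have cs: "c * s = G 0"
      using c by (simp add: s_def)
    have "s \<noteq> 0"
      using cs Gpos[of 0] by auto
    then have "\<exists>z. G 0 - G (- s) = s * (c * exp (z\<^sup>2 / (2 * a)))"
    proof (cases "s > 0")
      case True
      then show ?thesis
        using MVT2[of "- s" 0 G "\<lambda>x. c * exp (x\<^sup>2 / (2 * a))"] G by auto
    next
      case False
      then obtain z where "G (- s) - G 0 = (- s - 0) * (c * exp (z\<^sup>2 / (2 * a)))"
        using MVT2[of 0 "- s" G "\<lambda>x. c * exp (x\<^sup>2 / (2 * a))"] G \<open>s \<noteq> 0\<close> by auto
      then show ?thesis
        by (intro exI[of _ z]) simp
    qed
    then obtain z where "G 0 - G (- s) = G 0 * exp (z\<^sup>2 / (2 * a))"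
      using cs by (metis mult.assoc mult.commute)
    moreover have "G 0 * exp (z\<^sup>2 / (2 * a)) \<ge> G 0 * 1"
      using e1 Gpos[of 0] by (intro mult_left_mono) auto
    ultimately show False
      using Gpos[of "- s"] by simp
  qed
  then have "G x = G 0"
    using G by (intro DERIV_isconst_all[of G]) auto
  then show ?thesis
    by (simp add: G_def exp_minus field_simps)
qed

lemma brs_stationary_iff:
  assumes "\<sigma> > 0" "\<beta> > 0"
  shows "brs_stationary \<sigma> \<beta> m \<longleftrightarrow> m = normal_density 0 (sqrt (a2 \<sigma> \<beta>))"
proof
  define a where "a = a2 \<sigma> \<beta>"
  define k where "k = 1 + \<sigma>\<^sup>2 / 2"
  have a: "a > 0"
    using a2_pos[OF assms(2)] by (simp add: a_def)
  have k: "k > 0"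
    by (simp add: k_def add_pos_nonneg)
  have ak: "2 * \<beta> = k / a"
  proof -
    have "2 * \<beta> * a = k"
      unfolding a_def a2_def k_def using assms(2) by (simp add: field_simps)
    then show ?thesis
      using a by (simp add: field_simps)
  qed
  {
    assume brs: "brs_stationary \<sigma> \<beta> m"
    then have reg: "regular_density m"
      by (simp add: brs_stationary_def)
    then have pos: "\<And>x. 0 < m x" and dm: "\<And>x. m differentiable (at x)"
      and ddm: "\<And>x. deriv m differentiable (at x)"
      by (auto simp: regular_density_def twice_differentiable_def)
    have Dm: "(m has_real_derivative deriv m x) (at x)" for x
      using dm by (simp add: DERIV_deriv_iff_real_differentiable)
    have DDm: "(deriv m has_real_derivative deriv (deriv m) x) (at x)" for x
      using ddm by (simp add: DERIV_deriv_iff_real_differentiable)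
    define F where "F = (\<lambda>x. k * deriv m x + 2 * \<beta> * x * m x)"
    have "(F has_real_derivative 0) (at x)" for x
    proof -
      define d where "d = deriv (deriv m) x + 2 * \<beta> * (m x + x * deriv m x)"
      have d: "((\<lambda>y. deriv m y + 2 * \<beta> * y * m y) has_real_derivative d) (at x)"
        unfolding d_def
        by (auto intro!: derivative_eq_intros Dm DDm simp: algebra_simps)
      have "deriv (\<lambda>y. m y * deriv (\<lambda>z. ln (m z) + \<beta> * z\<^sup>2) y) x
              + \<sigma>\<^sup>2 / 2 * deriv (deriv m) x = 0"
        using brs unfolding brs_stationary_def by blast
      then have z: "d + \<sigma>\<^sup>2 / 2 * deriv (deriv m) x = 0"
        unfolding brs_flux_eq[OF pos dm] DERIV_imp_deriv[OF d] .
      have "F = (\<lambda>y. (deriv m y + 2 * \<beta> * y * m y) + \<sigma>\<^sup>2 / 2 * deriv m y)"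
        by (auto simp: F_def k_def algebra_simps)
      then show ?thesis
        using DERIV_add[OF d DERIV_cmult[OF DDm, of "\<sigma>\<^sup>2 / 2"]] z by simp
    qed
    then have "F x = F 0" for x
      by (intro DERIV_isconst_all[of F]) auto
    then have "deriv m x = F 0 / k - x / a * m x" for x
    proof -
      have "k * deriv m x + k / a * x * m x = F 0"
        using \<open>F x = F 0\<close> unfolding F_def ak by simp
      then have "k * (deriv m x + x / a * m x) = F 0"
        by (simp add: algebra_simps)
      then show ?thesis
        using k by (simp add: field_simps)
    qed
    then have "(m has_real_derivative F 0 / k - x / a * m x) (at x)" for x
      using Dm[of x] by simp
    from positive_constant_flux[OF a pos this]
    have "m x = m 0 * exp (- x\<^sup>2 / (2 * a))" for x .
    moreover have "has_bochner_integral lborel m 1"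
      using reg by (simp add: regular_density_def)
    ultimately have "m = normal_density 0 (sqrt a)"
      by (rule normal_density_if_proportional[OF a])
    then show "m = normal_density 0 (sqrt (a2 \<sigma> \<beta>))"
      by (simp only: a_def)
  }
  {
    assume "m = normal_density 0 (sqrt (a2 \<sigma> \<beta>))"
    then have m: "m = normal_density 0 (sqrt a)"
      by (simp add: a_def)
    have reg: "regular_density m"
      unfolding m by (rule regular_density_normal_density_centred[OF a])
    then have pos: "\<And>x. 0 < m x" and dm: "\<And>x. m differentiable (at x)"
      by (auto simp: regular_density_def twice_differentiable_def)
    have "deriv (\<lambda>y. m y * deriv (\<lambda>z. ln (m z) + \<beta> * z\<^sup>2) y) x
            + \<sigma>\<^sup>2 / 2 * deriv (deriv m) x = 0" for x
    proof -
      have 1: "deriv (deriv m) x = - (1 / a) * (1 - x\<^sup>2 / a) * m x"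
        unfolding m by (rule DERIV_imp_deriv) (rule deriv2_normal_density_centred[OF a])
      have eq: "(\<lambda>y. deriv m y + 2 * \<beta> * y * m y) = (\<lambda>y. (k - 1) / a * y * m y)"
        unfolding ak m deriv_normal_density_centred[OF a]
        using a by (auto simp: field_simps)
      have 2: "deriv (\<lambda>y. deriv m y + 2 * \<beta> * y * m y) x = (k - 1) / a * (1 - x\<^sup>2 / a) * m x"
        unfolding eq unfolding m
        by (rule DERIV_imp_deriv) (rule deriv_times_normal_density_centred[OF a])
      show ?thesis
        unfolding brs_flux_eq[OF pos dm] 1 2 by (simp add: k_def)
    qed
    then show "brs_stationary \<sigma> \<beta> m"
      using reg by (simp add: brs_stationary_def)
  }
qed

section \<open>Limits of the ratio of the variances\<close>

lemma variance_ratio_limit_sigma: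
  assumes "\<beta> > 0"
  shows "((\<lambda>s. a2 (sqrt s) \<beta> / a1 (sqrt s) \<beta>) \<longlongrightarrow> 1) (at_right 0)"
    and "((\<lambda>s. a2 (sqrt s) \<beta> / a1 (sqrt s) \<beta>) \<longlongrightarrow> 1 / sqrt (2 * \<beta>)) at_top"
proof -
  have "((\<lambda>s. (2 + s) / (1 + sqrt (1 + 2 * s\<^sup>2 * \<beta>))) \<longlongrightarrow> 1) (at_right 0)"
    by (rule tendsto_eq_intros | simp)+
  then show "((\<lambda>s. a2 (sqrt s) \<beta> / a1 (sqrt s) \<beta>) \<longlongrightarrow> 1) (at_right 0)"
    by (rule Lim_transform_eventually)
      (use assms in \<open>auto simp: eventually_at_filter variance_ratio_sqrt\<close>)
  have "((\<lambda>s. (2 + s) / (1 + sqrt (1 + 2 * s\<^sup>2 * \<beta>))) \<longlongrightarrow> inverse ((2 * \<beta>) powr (1 / 2))) at_top"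
    using assms by real_asymp
  then have "((\<lambda>s. (2 + s) / (1 + sqrt (1 + 2 * s\<^sup>2 * \<beta>))) \<longlongrightarrow> 1 / sqrt (2 * \<beta>)) at_top"
    using assms by (simp add: powr_half_sqrt inverse_eq_divide)
  moreover have "\<forall>\<^sub>F s in at_top. (2 + s) / (1 + sqrt (1 + 2 * s\<^sup>2 * \<beta>))
                    = a2 (sqrt s) \<beta> / a1 (sqrt s) \<beta>"
    using eventually_gt_at_top[of 0] by eventually_elim (use assms in \<open>simp add: variance_ratio_sqrt\<close>)
  ultimately show "((\<lambda>s. a2 (sqrt s) \<beta> / a1 (sqrt s) \<beta>) \<longlongrightarrow> 1 / sqrt (2 * \<beta>)) at_top"
    by (rule Lim_transform_eventually)
qed

lemma variance_ratio_limit_beta: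
  assumes "\<sigma> > 0"
  shows "((\<lambda>\<beta>. a2 \<sigma> \<beta> / a1 \<sigma> \<beta>) \<longlongrightarrow> 1 + \<sigma>\<^sup>2 / 2) (at_right 0)"
    and "((\<lambda>\<beta>. sqrt (2 * \<beta>) * (a2 \<sigma> \<beta> / a1 \<sigma> \<beta>)) \<longlongrightarrow> (2 + \<sigma>\<^sup>2) / \<sigma>\<^sup>2) at_top"
proof -
  have "((\<lambda>\<beta>. (2 + \<sigma>\<^sup>2) / (1 + sqrt (1 + 2 * \<sigma>^4 * \<beta>))) \<longlongrightarrow> 1 + \<sigma>\<^sup>2 / 2) (at_right 0)"
    by (rule tendsto_eq_intros | simp add: field_simps)+
  then show "((\<lambda>\<beta>. a2 \<sigma> \<beta> / a1 \<sigma> \<beta>) \<longlongrightarrow> 1 + \<sigma>\<^sup>2 / 2) (at_right 0)"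
    by (rule Lim_transform_eventually)
      (use assms in \<open>auto simp: eventually_at_filter variance_ratio\<close>)
  define c where "c = \<sigma>\<^sup>2"
  have c: "c > 0" "\<sigma>^4 = c\<^sup>2"
    using assms by (auto simp: c_def)
  have "((\<lambda>\<beta>. sqrt (2 * \<beta>) * ((2 + c) / (1 + sqrt (1 + 2 * c\<^sup>2 * \<beta>))))
               \<longlongrightarrow> 2 powr (1 / 2) * ((2 + c) * inverse ((2 * c\<^sup>2) powr (1 / 2)))) at_top"
    using c(1) by real_asymp
  moreover have "2 powr (1 / 2) * ((2 + c) * inverse ((2 * c\<^sup>2) powr (1 / 2))) = (2 + c) / c"
    using c(1) by (simp add: powr_half_sqrt real_sqrt_mult field_simps)
  ultimately have "((\<lambda>\<beta>. sqrt (2 * \<beta>) * ((2 + c) / (1 + sqrt (1 + 2 * c\<^sup>2 * \<beta>)))) \<longlongrightarrow> (2 + c) / c) at_top"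
    by simp
  then have "((\<lambda>\<beta>. sqrt (2 * \<beta>) * ((2 + \<sigma>\<^sup>2) / (1 + sqrt (1 + 2 * \<sigma>^4 * \<beta>))))
               \<longlongrightarrow> (2 + \<sigma>\<^sup>2) / \<sigma>\<^sup>2) at_top"
    unfolding c(2) c_def[symmetric] .
  moreover have "\<forall>\<^sub>F \<beta> in at_top. sqrt (2 * \<beta>) * ((2 + \<sigma>\<^sup>2) / (1 + sqrt (1 + 2 * \<sigma>^4 * \<beta>)))
                    = sqrt (2 * \<beta>) * (a2 \<sigma> \<beta> / a1 \<sigma> \<beta>)"
    using eventually_gt_at_top[of 0] by eventually_elim (use assms in \<open>simp add: variance_ratio\<close>)
  ultimately show "((\<lambda>\<beta>. sqrt (2 * \<beta>) * (a2 \<sigma> \<beta> / a1 \<sigma> \<beta>)) \<longlongrightarrow> (2 + \<sigma>\<^sup>2) / \<sigma>\<^sup>2) at_top"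
    by (rule Lim_transform_eventually)
qed

section \<open>Stationary distributions and comparison of the variances\<close>

theorem proposition4p3:
  shows "(\<forall>\<sigma>>0. \<forall>\<beta>>0.
            0 < a1 \<sigma> \<beta> \<and> 0 < a2 \<sigma> \<beta> \<and>
            (\<forall>m. mfg_stationary \<sigma> \<beta> m \<longleftrightarrow> m = normal_density 0 (sqrt (a1 \<sigma> \<beta>))) \<and>
            (\<forall>m. brs_stationary \<sigma> \<beta> m \<longleftrightarrow> m = normal_density 0 (sqrt (a2 \<sigma> \<beta>)))) \<and>
         (\<forall>\<beta>>0.
            ((\<lambda>s. a2 (sqrt s) \<beta> / a1 (sqrt s) \<beta>) \<longlongrightarrow> 1) (at_right 0) \<and>
            ((\<lambda>s. a2 (sqrt s) \<beta> / a1 (sqrt s) \<beta>) \<longlongrightarrow> 1 / sqrt (2 * \<beta>)) at_top) \<and>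
         (\<forall>\<sigma>>0.
            ((\<lambda>\<beta>. a2 \<sigma> \<beta> / a1 \<sigma> \<beta>) \<longlongrightarrow> 1 + \<sigma>\<^sup>2 / 2) (at_right 0) \<and>
            ((\<lambda>\<beta>. sqrt (2 * \<beta>) * (a2 \<sigma> \<beta> / a1 \<sigma> \<beta>)) \<longlongrightarrow> (2 + \<sigma>\<^sup>2) / \<sigma>\<^sup>2) at_top)"
  by (intro conjI allI impI a1_pos a2_pos mfg_stationary_iff brs_stationary_iff
      variance_ratio_limit_sigma variance_ratio_limit_beta)

end
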